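(* Let $0\le i-1<n$ and let $M_{i-1},\dots,M_n$ be Event-B machines such that $M_{i-1} \preccurlyeq_W \cdots \preccurlyeq_W M_n$ is a refinement chain obeying the development strategy described in the context (events may be renamed and split along the chain), and let $g_{i,n}$ be the associated partial function from $\alpha M_n$ to $\alpha M_{i-1}$ mapping each event of $M_n$ to the event of $M_{i-1}$ it ultimately refines, if any. Let $\phi$ be an LTL formula and $\beta$ a set of events. If $M_{i-1}\models\phi$, $M_n$ is deadlock free, $M_n$ does not contain any anticipated events, $\phi$ is $\beta$-dependent, and $\beta\subseteq\alpha M_{i-1}$, then $$M_n\models trans_{g_{i,n}}(\phi).$$
   Context: Fix an infinite set $\Sigma$ of event names. **Machines.** An Event-B machine $M$ has a set of states (values $v$ of its variables), an invariant $I(v)$, a non-empty set of initial states, and a finite set $\alpha M\subseteq\Sigma$ of events (its alphabet; initialisation is not in it). Each event $e$ has a guard $G_e(x,v)$ and a before-after predicate $BA_e(v,x,v')$, where $x$ are the (optional) parameters. Event $e$ is enabled in $v$ if $\exists x.\,G_e(x,v)$; write $v\xrightarrow{e}v'$ if $\exists x.\,G_e(x,v)\wedge BA_e(v,x,v')$. All initial states satisfy $I$, and $I(v)$ and $v\xrightarrow{e}v'$ imply $I(v')$. Events are feasible: if $I(v)$ holds and $e$ is enabled in $v$ then $v\xrightarrow{e}v'$ for some $v'$. $M$ is deadlock free if in every state satisfying $I$ at least one event is enabled. Every event carries exactly one label: ordinary, anticipated or convergent. **Traces.** A trace of $M$ is a maximal execution: either an infinite sequence $\langle e_0,e_1,\dots\rangle$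 of events such that $v_0\xrightarrow{e_0}v_1\xrightarrow{e_1}\cdots$ for some states with $v_0$ initial, or a finite sequence $\langle e_0,\dots,e_{k-1}\rangle$ with $v_0\xrightarrow{e_0}\cdots\xrightarrow{e_{k-1}}v_k$, $v_0$ initial, and no event enabled in $v_k$. **Refinement.** Let $M$ (states $v$, invariant $I$) and $M'$ (states $w$, invariant $I'$) be machines, with a specification of which events of $M'$ refine which events of $M$ (each event of $M'$ refines at most one event of $M$, several events of $M'$ may refine the same event of $M$; an event refining none is called new). $M\preccurlyeq_W M'$ means there are a linking invariant $J(v,w)$ and a natural-number-valued variant $V(w)$ such that: every initial $w$ has an initial $v$ with $J(v,w)$; and for all $v,w$ with $I(v), I'(w), J(v,w)$ and all $e'\in\alpha M'$: (feasibility) if $e'$ is enabled in $w$ then $w\xrightarrow{e'}w'$ for some $w'$; (guard strengthening) if $e'$ refines $e$ and $e'$ is enabled in $w$ then $e$ is enabled in $v$; (simulation) if $w\xrightarrow{e'}w'$ and $e'$ refines $e$ then there is $v'$ with $v\xrightarrow{e}v'$ and $J(v',w')$, while if $w\xrightarrow{e'}w'$ and $e'$ is new then $J(v,w')$; (variant) if $w\xrightarrow{e'}w'$ then $V(w')<V(w)$ when $e'$ is convergent and $V(w')\le V(w)$ when $e'$ is anticipated. **Development strategy** for the chain: all events of the machine with index $0$ (if it is in the chain) are ordinary; and for each pair of consecutive machines $M_k\preccurlyeq_W M_{k+1}$: each event of $M_k$ is refined by at least one event of $M_{k+1}$; each new event of $M_{k+1}$ is anticipated or convergent; each event of $M_{k+1}$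 refining an anticipated event of $M_k$ is anticipated or convergent; each event of $M_{k+1}$ refining a convergent or ordinary event of $M_k$ is ordinary. **Renaming functions.** For $i\le k\le n$, $f_k$ is the partial surjection from $\alpha M_k$ to $\alpha M_{k-1}$ with $f_k(e')=e$ iff $e'$ refines $e$ (undefined on new events). $g_{i,n}$ is the composition applying $f_n$ first, then $f_{n-1}$, and so on down to $f_i$ (a partial function from $\alpha M_n$ to $\alpha M_{i-1}$). **LTL.** Formulae: $\phi::=true\mid[x]\mid\neg\phi\mid\phi\vee\phi\mid\phi\,U\,\phi$ with $x\in\Sigma$ ($\wedge$, $F$, $G$ are derived as usual). For a finite or infinite sequence $u$ of events, $u^k$ denotes $u$ with its first $k$ elements removed ($k$ ranges over indices not exceeding the length of $u$). $u\models true$ always; $u\models[x]$ iff $u$ is non-empty with first element $x$; $\neg,\vee$ as usual; $u\models\phi_1U\phi_2$ iff there is $k\ge0$ with $u^k\models\phi_2$ and $u^i\models\phi_1$ for all $i<k$. $M\models\phi$ iff every trace of $M$ satisfies $\phi$. The alphabet $\alpha(\phi)$ is the set of events $x$ such that $[x]$ occurs in $\phi$. **$\beta$-dependence.** For a sequence $u$ and a set $\beta\subseteq\Sigma$, $u\upharpoonright\beta$ is the (finite or infinite) subsequence of $u$ consisting of the elements in $\beta$. $\phi$ is $\beta$-dependent if $\alpha(\phi)\subseteq\beta$ and, for all finite or infinite sequences $u$ over $\Sigma$, $u\models\phi\Leftrightarrow(u\upharpoonright\beta)\models\phi$. **Translation.** For a partial function $h$ between finite sets of events, $trans_h$ maps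 LTL formulae to LTL formulae: $trans_h(true)=true$; $trans_h([x])=\bigvee_{y\,\mid\,h(y)=x}[y]$ (the empty disjunction being false); and $trans_h$ commutes with $\neg,\vee,U$ (hence also with $\wedge,G,F$). *)

theory Defs
  imports Main "HOL-Library.Extended_Nat" "HOL-Library.Infinite_Set"
begin

section \<open>Event-B machines\<close>

datatype label = Ordinary | Anticipated | Convergent

text \<open>
  The type \<open>'e\<close> is the set of all event names. Machines carry an explicit set of states, so that
  the machines of one chain may have entirely different state spaces although they share the type
  \<open>'s\<close> (take for \<open>'s\<close> a disjoint union of the state spaces). In the same way
  \<open>'p\<close> is a common type for the parameters of all events; an event without parameters ignores
  its parameter. The fields \<open>guard\<close>, \<open>before_after\<close> and \<open>label_of\<close> are only
  meaningful for events in the alphabet.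
\<close>

record ('s, 'p, 'e) machine =
  states :: "'s set"
  invariant :: "'s \<Rightarrow> bool"
  inits :: "'s set"
  alphabet :: "'e set"
  guard :: "'e \<Rightarrow> 'p \<Rightarrow> 's \<Rightarrow> bool"
  before_after :: "'e \<Rightarrow> 's \<Rightarrow> 'p \<Rightarrow> 's \<Rightarrow> bool"
  label_of :: "'e \<Rightarrow> label"

definition enabled :: "('s, 'p, 'e) machine \<Rightarrow> 'e \<Rightarrow> 's \<Rightarrow> bool" where
  "enabled M e v \<longleftrightarrow> (\<exists>x. guard M e x v)"

definition step :: "('s, 'p, 'e) machine \<Rightarrow> 'e \<Rightarrow> 's \<Rightarrow> 's \<Rightarrow> bool" where
  "step M e v v' \<longleftrightarrow> (\<exists>x. guard M e x v \<and> before_after M e v x v')"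

text \<open>
  The first three conjuncts after the one on \<open>inits\<close> say that invariant, guards and
  before-after predicates are predicates on the states of the machine (false elsewhere). Hence
  quantifiers restricted by one of these predicates range over states only.
\<close>

definition event_b_machine :: "('s, 'p, 'e) machine \<Rightarrow> bool" where
  "event_b_machine M \<longleftrightarrow>
     inits M \<subseteq> states M \<and>
     (\<forall>v. invariant M v \<longrightarrow> v \<in> states M) \<and>
     (\<forall>e\<in>alphabet M. \<forall>x v. guard M e x v \<longrightarrow> v \<in> states M) \<and>
     (\<forall>e\<in>alphabet M. \<forall>v x v'. before_after M e v x v' \<longrightarrow> v \<in> states M \<and> v' \<in> states M) \<and>
     finite (alphabet M) \<and>
     inits M \<noteq> {} \<and>
     (\<forall>v\<in>inits M. invariant M v) \<and>
     (\<forall>e\<in>alphabet M. \<forall>v v'. invariant M v \<and> step M e v v' \<longrightarrow> invariant M v') \<and>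
     (\<forall>e\<in>alphabet M. \<forall>v. invariant M v \<and> enabled M e v \<longrightarrow> (\<exists>v'. step M e v v'))"

definition deadlock_free :: "('s, 'p, 'e) machine \<Rightarrow> bool" where
  "deadlock_free M \<longleftrightarrow> (\<forall>v. invariant M v \<longrightarrow> (\<exists>e\<in>alphabet M. enabled M e v))"


section \<open>Finite and infinite sequences\<close>

datatype 'e seq = Fin "'e list" | Inf "nat \<Rightarrow> 'e"

fun seq_length :: "'e seq \<Rightarrow> enat" where
  "seq_length (Fin xs) = enat (length xs)"
| "seq_length (Inf w) = \<infinity>"

fun seq_drop :: "nat \<Rightarrow> 'e seq \<Rightarrow> 'e seq" where
  "seq_drop k (Fin xs) = Fin (drop k xs)"
| "seq_drop k (Inf w) = Inf (\<lambda>j. w (k + j))"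

fun seq_starts_with :: "'e seq \<Rightarrow> 'e \<Rightarrow> bool" where
  "seq_starts_with (Fin xs) x \<longleftrightarrow> xs \<noteq> [] \<and> hd xs = x"
| "seq_starts_with (Inf w) x \<longleftrightarrow> w 0 = x"

text \<open>
  For an infinite sequence, the positions carrying an element of \<open>\<beta>\<close> are listed in
  increasing order; the result is finite iff there are only finitely many of them.
\<close>

fun seq_restrict :: "'e seq \<Rightarrow> 'e set \<Rightarrow> 'e seq" where
  "seq_restrict (Fin xs) \<beta> = Fin (filter (\<lambda>x. x \<in> \<beta>) xs)"
| "seq_restrict (Inf w) \<beta> =
     (let K = {k. w k \<in> \<beta>} in
      if finite K then Fin (map w (sorted_list_of_set K))
      else Inf (\<lambda>j. w (enumerate K j)))"

fun is_trace :: "('s, 'p, 'e) machine \<Rightarrow> 'e seq \<Rightarrow> bool" where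
  "is_trace M (Fin es) \<longleftrightarrow>
     (\<exists>v. v 0 \<in> inits M \<and>
        (\<forall>k<length es. es ! k \<in> alphabet M \<and> step M (es ! k) (v k) (v (Suc k))) \<and>
        \<not> (\<exists>e\<in>alphabet M. enabled M e (v (length es))))"
| "is_trace M (Inf w) \<longleftrightarrow>
     (\<exists>v. v 0 \<in> inits M \<and> (\<forall>k. w k \<in> alphabet M \<and> step M (w k) (v k) (v (Suc k))))"


section \<open>Refinement\<close>

text \<open>
  The specification of which events of \<open>M'\<close> refine which events of \<open>M\<close> is a partial function
  \<open>f\<close>: \<open>f e' = Some e\<close> iff \<open>e'\<close> refines \<open>e\<close>; the new events are those of
  \<open>alphabet M'\<close> outside the domain of \<open>f\<close>.
\<close>

definition refines_via ::
  "('e \<Rightarrow> 'e option) \<Rightarrow> ('s, 'p, 'e) machine \<Rightarrow> ('t, 'q, 'e) machine \<Rightarrow>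
   ('s \<Rightarrow> 't \<Rightarrow> bool) \<Rightarrow> ('t \<Rightarrow> nat) \<Rightarrow> bool" where
  "refines_via f M M' J V \<longleftrightarrow>
     (\<forall>w\<in>inits M'. \<exists>v\<in>inits M. J v w) \<and>
     (\<forall>v w. invariant M v \<and> invariant M' w \<and> J v w \<longrightarrow>
        (\<forall>e'\<in>alphabet M'.
           (enabled M' e' w \<longrightarrow> (\<exists>w'. step M' e' w w')) \<and>
           (\<forall>e. f e' = Some e \<and> enabled M' e' w \<longrightarrow> enabled M e v) \<and>
           (\<forall>e w'. f e' = Some e \<and> step M' e' w w' \<longrightarrow> (\<exists>v'. step M e v v' \<and> J v' w')) \<and>
           (\<forall>w'. f e' = None \<and> step M' e' w w' \<longrightarrow> J v w') \<and>
           (\<forall>w'. label_of M' e' = Convergent \<and> step M' e' w w' \<longrightarrow> V w' < V w) \<and>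
           (\<forall>w'. label_of M' e' = Anticipated \<and> step M' e' w w' \<longrightarrow> V w' \<le> V w)))"

definition refined_by ::
  "('e \<Rightarrow> 'e option) \<Rightarrow> ('s, 'p, 'e) machine \<Rightarrow> ('t, 'q, 'e) machine \<Rightarrow> bool" where
  "refined_by f M M' \<longleftrightarrow>
     dom f \<subseteq> alphabet M' \<and> ran f \<subseteq> alphabet M \<and> (\<exists>J V. refines_via f M M' J V)"

definition strategy_step ::
  "('e \<Rightarrow> 'e option) \<Rightarrow> ('s, 'p, 'e) machine \<Rightarrow> ('t, 'q, 'e) machine \<Rightarrow> bool" where
  "strategy_step f M M' \<longleftrightarrow>
     (\<forall>e\<in>alphabet M. \<exists>e'\<in>alphabet M'. f e' = Some e) \<and>
     (\<forall>e'\<in>alphabet M'. f e' = None \<longrightarrow> label_of M' e' \<in> {Anticipated, Convergent}) \<and>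
     (\<forall>e'\<in>alphabet M'. \<forall>e. f e' = Some e \<and> label_of M e = Anticipated \<longrightarrow>
        label_of M' e' \<in> {Anticipated, Convergent}) \<and>
     (\<forall>e'\<in>alphabet M'. \<forall>e. f e' = Some e \<and> label_of M e \<in> {Convergent, Ordinary} \<longrightarrow>
        label_of M' e' = Ordinary)"

text \<open>
  The chain consists of \<open>M m, \<dots>, M n\<close>, and \<open>f k\<close> relates the events of \<open>M k\<close> to those of
  \<open>M (k - 1)\<close>. The condition on ordinary events concerns \<open>M 0\<close> only, and is void for chains
  not containing it.
\<close>

definition refinement_chain ::
  "(nat \<Rightarrow> 'e \<Rightarrow> 'e option) \<Rightarrow> (nat \<Rightarrow> ('s, 'p, 'e) machine) \<Rightarrow> nat \<Rightarrow> nat \<Rightarrow> bool" where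
  "refinement_chain f M m n \<longleftrightarrow> (\<forall>k. m < k \<and> k \<le> n \<longrightarrow> refined_by (f k) (M (k - 1)) (M k))"

definition development_strategy ::
  "(nat \<Rightarrow> 'e \<Rightarrow> 'e option) \<Rightarrow> (nat \<Rightarrow> ('s, 'p, 'e) machine) \<Rightarrow> nat \<Rightarrow> nat \<Rightarrow> bool" where
  "development_strategy f M m n \<longleftrightarrow>
     (m = 0 \<longrightarrow> (\<forall>e\<in>alphabet (M 0). label_of (M 0) e = Ordinary)) \<and>
     (\<forall>k. m < k \<and> k \<le> n \<longrightarrow> strategy_step (f k) (M (k - 1)) (M k))"

text \<open>\<open>f i \<circ>\<^sub>m (f (i + 1) \<circ>\<^sub>m \<dots> (f n \<circ>\<^sub>m Some))\<close>, for \<open>i \<le> n\<close>\<close>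

definition renaming :: "(nat \<Rightarrow> 'e \<Rightarrow> 'e option) \<Rightarrow> nat \<Rightarrow> nat \<Rightarrow> 'e \<Rightarrow> 'e option" where
  "renaming f i n = foldr (\<lambda>k h. f k \<circ>\<^sub>m h) [i..<Suc n] Some"


section \<open>LTL\<close>

datatype (atoms: 'e) ltl =
    LTrue
  | Atom 'e
  | LNot "'e ltl"
  | LOr "'e ltl" "'e ltl"
  | LUntil "'e ltl" "'e ltl"

primrec sat :: "'e seq \<Rightarrow> 'e ltl \<Rightarrow> bool" (infix "\<Turnstile>" 50) where
  "u \<Turnstile> LTrue \<longleftrightarrow> True"
| "u \<Turnstile> Atom x \<longleftrightarrow> seq_starts_with u x"
| "u \<Turnstile> LNot \<phi> \<longleftrightarrow> \<not> u \<Turnstile> \<phi>"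
| "u \<Turnstile> LOr \<phi> \<psi> \<longleftrightarrow> u \<Turnstile> \<phi> \<or> u \<Turnstile> \<psi>"
| "u \<Turnstile> LUntil \<phi> \<psi> \<longleftrightarrow>
     (\<exists>k. enat k \<le> seq_length u \<and> seq_drop k u \<Turnstile> \<psi> \<and> (\<forall>i<k. seq_drop i u \<Turnstile> \<phi>))"

definition machine_sat :: "('s, 'p, 'e) machine \<Rightarrow> 'e ltl \<Rightarrow> bool" where
  "machine_sat M \<phi> \<longleftrightarrow> (\<forall>u. is_trace M u \<longrightarrow> u \<Turnstile> \<phi>)"

definition beta_dependent :: "'e set \<Rightarrow> 'e ltl \<Rightarrow> bool" where
  "beta_dependent \<beta> \<phi> \<longleftrightarrow> atoms \<phi> \<subseteq> \<beta> \<and> (\<forall>u. u \<Turnstile> \<phi> \<longleftrightarrow> seq_restrict u \<beta> \<Turnstile> \<phi>)"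

fun list_disj :: "'e ltl list \<Rightarrow> 'e ltl" where
  "list_disj [] = LNot LTrue"
| "list_disj [\<phi>] = \<phi>"
| "list_disj (\<phi> # \<psi> # \<phi>s) = LOr \<phi> (list_disj (\<psi> # \<phi>s))"

text \<open>
  Disjunction of the atoms of a finite set of events, in an arbitrary but fixed order
\<close>

definition atoms_disj :: "'e set \<Rightarrow> 'e ltl" where
  "atoms_disj A = list_disj (map Atom (SOME ys. distinct ys \<and> set ys = A))"

lemma sat_list_disj: "u \<Turnstile> list_disj \<phi>s \<longleftrightarrow> (\<exists>\<phi>\<in>set \<phi>s. u \<Turnstile> \<phi>)"
  by (induction \<phi>s rule: list_disj.induct) auto

lemma sat_atoms_disj:
  assumes "finite A"
  shows "u \<Turnstile> atoms_disj A \<longleftrightarrow> (\<exists>y\<in>A. u \<Turnstile> Atom y)"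
proof -
  have "\<exists>ys. distinct ys \<and> set ys = A"
    using finite_distinct_list[OF assms] by blast
  then have "set (SOME ys. distinct ys \<and> set ys = A) = A"
    by (metis (mono_tags, lifting) someI_ex)
  then show ?thesis
    by (simp add: atoms_disj_def sat_list_disj del: sat.simps)
qed

text \<open>To be used for \<open>h\<close> with finite domain\<close>

primrec trans_ltl :: "('e \<Rightarrow> 'e option) \<Rightarrow> 'e ltl \<Rightarrow> 'e ltl" where
  "trans_ltl h LTrue = LTrue"
| "trans_ltl h (Atom x) = atoms_disj {y. h y = Some x}"
| "trans_ltl h (LNot \<phi>) = LNot (trans_ltl h \<phi>)"
| "trans_ltl h (LOr \<phi> \<psi>) = LOr (trans_ltl h \<phi>) (trans_ltl h \<psi>)"
| "trans_ltl h (LUntil \<phi> \<psi>) = LUntil (trans_ltl h \<phi>) (trans_ltl h \<psi>)"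

end

theory Submission
  imports Defs
begin

text \<open>
  An infinite trace of \<open>M n\<close> is simulated on every level \<open>k\<close> by a run that performs the event
  ultimately refined by the current concrete event, and stutters if there is none. Suppose that from
  some point on a run of level \<open>k - 1\<close> performs only anticipated events. Then all events of level \<open>k\<close>
  are from there on anticipated or convergent, so the variant of level \<open>k\<close> is eventually constant, and
  eventually only anticipated events remain on level \<open>k\<close> as well. As \<open>M n\<close> has no anticipated
  events and its run never stutters, this cannot happen on any level; in particular, the run of
  \<open>M (i - 1)\<close> performs infinitely many events, and omitting its stuttering steps yields a trace. If
  the stuttering steps are filled with a fresh event instead, the resulting sequence satisfies
  \<open>\<phi>\<close> iff the concrete trace satisfies the translation, and \<open>\<beta>\<close>-dependence identifies the two.
\<close>

section \<open>Stuttering runs\<close>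

text \<open>\<open>None\<close> marks a step in which the machine rests. The runs of all levels thus
  share one clock and can be linked state by state.\<close>

definition stuttering_run ::
  "('s, 'p, 'e) machine \<Rightarrow> (nat \<Rightarrow> 'e option) \<Rightarrow> (nat \<Rightarrow> 's) \<Rightarrow> bool" where
  "stuttering_run M a v \<longleftrightarrow>
     v 0 \<in> inits M \<and>
     (\<forall>t. a t = None \<longrightarrow> v (Suc t) = v t) \<and>
     (\<forall>t e. a t = Some e \<longrightarrow> e \<in> alphabet M \<and> step M e (v t) (v (Suc t)))"

text \<open>Resting is allowed, so a run that finally only rests falls under this as well; the
  negation therefore also yields infinitely many performed events.\<close>

definition eventually_anticipated ::
  "('s, 'p, 'e) machine \<Rightarrow> (nat \<Rightarrow> 'e option) \<Rightarrow> bool" where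
  "eventually_anticipated M a \<longleftrightarrow>
     (\<exists>N. \<forall>t\<ge>N. \<forall>e. a t = Some e \<longrightarrow> label_of M e = Anticipated)"

lemma invariant_init:
  "event_b_machine M \<Longrightarrow> v \<in> inits M \<Longrightarrow> invariant M v"
  unfolding event_b_machine_def by blast

lemma invariant_step:
  "event_b_machine M \<Longrightarrow> e \<in> alphabet M \<Longrightarrow> invariant M v \<Longrightarrow> step M e v v' \<Longrightarrow> invariant M v'"
  unfolding event_b_machine_def by blast

lemma stuttering_run_invariant:
  assumes "event_b_machine M" "stuttering_run M a v"
  shows "invariant M (v t)"
proof (induction t)
  case 0
  then show ?case
    using assms(2) invariant_init[OF assms(1)] by (simp add: stuttering_run_def)
next
  case (Suc t)
  then show ?case
    using assms(2) invariant_step[OF assms(1)]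
    by (cases "a t") (simp_all add: stuttering_run_def, blast)
qed

lemma stuttering_run_const:
  assumes "stuttering_run M a v" "s \<le> t" "\<And>r. s \<le> r \<Longrightarrow> r < t \<Longrightarrow> a r = None"
  shows "v t = v s"
  using assms(2,3)
proof (induction t rule: dec_induct)
  case (step r)
  then show ?case
    using assms(1) by (simp add: stuttering_run_def)
qed simp

text \<open>The state does not change between two consecutive performed events, so the states at the
  times of these events form an execution. Being infinite, it is maximal.\<close>

lemma trace_of_stuttering_run:
  assumes run: "stuttering_run M a v" and inf: "infinite {t. a t \<noteq> None}"
  shows "is_trace M (Inf (\<lambda>j. the (a (enumerate {t. a t \<noteq> None} j))))"
proof -
  let ?K = "{t. a t \<noteq> None}"
  let ?c = "enumerate ?K"
  have mem: "a (?c j) \<noteq> None" for j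
    using enumerate_in_set[OF inf, of j] by simp
  have "v (?c 0) = v 0"
    using not_less_Least by (intro stuttering_run_const[OF run]) (fastforce simp: enumerate_0)+
  moreover have "v (?c (Suc j)) = v (Suc (?c j))" for j
  proof (rule stuttering_run_const[OF run])
    show "Suc (?c j) \<le> ?c (Suc j)"
      using enumerate_step[OF inf, of j] by simp
    \<comment> \<open>The next enumerated time is the least element of \<open>?K\<close> above
      \<open>?c j\<close>, so nothing is performed in between.\<close>
    show "a r = None" if "Suc (?c j) \<le> r" "r < ?c (Suc j)" for r
      using that not_less_Least[of r "\<lambda>s. s \<in> ?K \<and> ?c j < s"]
      unfolding enumerate_Suc''[OF inf] by auto
  qed
  ultimately have "v (?c 0) \<in> inits M"
    "the (a (?c j)) \<in> alphabet M \<and> step M (the (a (?c j))) (v (?c j)) (v (?c (Suc j)))" for j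
    using run mem[of j] unfolding stuttering_run_def by auto
  then show ?thesis
    by (auto intro!: exI[of _ "\<lambda>j. v (?c j)"])
qed

lemma deadlock_free_trace_infinite:
  assumes "event_b_machine M" "deadlock_free M" "is_trace M u"
  obtains w v where "u = Inf w" "stuttering_run M (\<lambda>t. Some (w t)) v"
proof (cases u)
  case (Fin es)
  then obtain v where v: "v 0 \<in> inits M"
    "\<forall>k<length es. es ! k \<in> alphabet M \<and> step M (es ! k) (v k) (v (Suc k))"
    "\<not> (\<exists>e\<in>alphabet M. enabled M e (v (length es)))"
    using assms(3) by auto
  \<comment> \<open>The bound stays in the induction because \<open>v\<close> is arbitrary beyond
    \<open>length es\<close>.\<close>
  have "k \<le> length es \<Longrightarrow> invariant M (v k)" for k
  proof (induction k)
    case 0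
    then show ?case using invariant_init[OF assms(1) v(1)] by simp
  next
    case (Suc k)
    then show ?case using invariant_step[OF assms(1)] v(2) by (meson Suc_le_lessD less_imp_le)
  qed
  then show ?thesis
    using v(3) assms(2) unfolding deadlock_free_def by blast
next
  case (Inf w)
  then show ?thesis
    using assms(3) that[of w] by (auto simp: stuttering_run_def)
qed


section \<open>Refinement of stuttering runs\<close>

text \<open>Simulation yields a successor only for an abstract state already chosen, so the states
  are picked one after the other by dependent choice; a new event makes the abstract run
  rest.\<close>

lemma refinement_abstract_run:
  assumes M: "event_b_machine M" and M': "event_b_machine M'"
    and ref: "refines_via f M M' J V"
    and ran: "ran f \<subseteq> alphabet M"
    and run: "stuttering_run M' a w"
  obtains v where "stuttering_run M (\<lambda>t. Option.bind (a t) f) v" "\<And>t. J (v t) (w t)"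
proof -
  let ?b = "\<lambda>t. Option.bind (a t) f"
  \<comment> \<open>The last conjunct carries the choice of an initial state through dependent
    choice.\<close>
  let ?P = "\<lambda>t x. J x (w t) \<and> invariant M x \<and> (t = 0 \<longrightarrow> x \<in> inits M)"
  let ?Q = "\<lambda>t x y. (?b t = None \<longrightarrow> y = x) \<and>
              (\<forall>e. ?b t = Some e \<longrightarrow> e \<in> alphabet M \<and> step M e x y)"
  have "\<exists>v. \<forall>t. ?P t (v t) \<and> ?Q t (v t) (v (Suc t))"
  proof (rule dependent_nat_choice)
    have "w 0 \<in> inits M'"
      using run by (simp add: stuttering_run_def)
    then show "\<exists>x. ?P 0 x"
      using ref invariant_init[OF M] unfolding refines_via_def by blast
  next
    fix x t
    assume P: "?P t x"
    have I': "invariant M' (w t)"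
      by (rule stuttering_run_invariant[OF M' run])
    show "\<exists>y. ?P (Suc t) y \<and> ?Q t x y"
    proof (cases "a t")
      case None
      then show ?thesis
        using P run by (auto simp: stuttering_run_def)
    next
      case (Some e')
      then have e': "e' \<in> alphabet M'" "step M' e' (w t) (w (Suc t))"
        using run by (auto simp: stuttering_run_def)
      show ?thesis
      proof (cases "f e'")
        case None
        then have "J x (w (Suc t))"
          using ref P I' e' unfolding refines_via_def by blast
        then show ?thesis
          using P Some None by auto
      next
        case (Some e)
        then have e: "e \<in> alphabet M"
          using ran by (auto simp: ran_def)
        obtain y where "step M e x y" "J y (w (Suc t))"
          using ref P I' e' Some unfolding refines_via_def by blast
        then show ?thesis
          using e \<open>a t = Some e'\<close> Some P invariant_step[OF M e] by auto
      qed
    qed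
  qed
  then obtain v where "\<forall>t. ?P t (v t) \<and> ?Q t (v t) (v (Suc t))" ..
  then show ?thesis
    using that[of v] by (auto simp: stuttering_run_def)
qed

lemma eventually_anticipated_refinement:
  assumes M: "event_b_machine M" and M': "event_b_machine M'"
    and ref: "refines_via f M M' J V"
    and strat: "strategy_step f M M'"
    and run: "stuttering_run M (\<lambda>t. Option.bind (a t) f) v"
    and run': "stuttering_run M' a w"
    and J: "\<And>t. J (v t) (w t)"
    and ant: "eventually_anticipated M (\<lambda>t. Option.bind (a t) f)"
  shows "eventually_anticipated M' a"
proof -
  obtain N where N: "\<And>t e. t \<ge> N \<Longrightarrow> Option.bind (a t) f = Some e \<Longrightarrow> label_of M e = Anticipated"
    using ant unfolding eventually_anticipated_def by blast
  have alph: "e' \<in> alphabet M'" "step M' e' (w t) (w (Suc t))" if "a t = Some e'" for t e'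
    using that run' by (auto simp: stuttering_run_def)
  \<comment> \<open>New events have these labels by the strategy; the others refine an event
    performed after \<open>N\<close>, which is anticipated.\<close>
  have lab: "label_of M' e' \<in> {Anticipated, Convergent}" if "t \<ge> N" "a t = Some e'" for t e'
    using strat N[OF that(1)] that(2) alph(1)[OF that(2)]
    unfolding strategy_step_def by (cases "f e'") auto
  have conv: "V (w (Suc t)) < V (w t)" if "a t = Some e'" "label_of M' e' = Convergent" for t e'
    using ref J that alph[OF that(1)] stuttering_run_invariant[OF M run]
      stuttering_run_invariant[OF M' run'] unfolding refines_via_def by blast
  have anti: "V (w (Suc t)) \<le> V (w t)" if "a t = Some e'" "label_of M' e' = Anticipated" for t e'
    using ref J that alph[OF that(1)] stuttering_run_invariant[OF M run]
      stuttering_run_invariant[OF M' run'] unfolding refines_via_def by blast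
  have le: "V (w (Suc t)) \<le> V (w t)" if "t \<ge> N" for t
  proof (cases "a t")
    case None
    then show ?thesis using run' by (simp add: stuttering_run_def)
  next
    case (Some e')
    then show ?thesis using lab[OF that Some] conv[OF Some] anti[OF Some] by auto
  qed
  \<comment> \<open>At \<open>T\<close> the variant attains its minimum over all times from
    \<open>N\<close> on; being non-increasing there, it is constant from \<open>T\<close> on, which
    excludes convergent events.\<close>
  obtain T where T: "T \<ge> N" "\<And>t. t \<ge> N \<Longrightarrow> V (w T) \<le> V (w t)"
    using ex_has_least_nat[of "\<lambda>t. t \<ge> N" N "\<lambda>t. V (w t)"] by auto
  have below: "V (w t) \<le> V (w T)" if "t \<ge> T" for t
    using that
  proof (induction t rule: dec_induct)
    case (step t)
    then show ?case using le[of t] T(1) by linarith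
  qed simp
  have "label_of M' e' = Anticipated" if "t \<ge> T" "a t = Some e'" for t e'
  proof (rule ccontr)
    assume "label_of M' e' \<noteq> Anticipated"
    then have "V (w (Suc t)) < V (w t)"
      using lab[of t e'] conv[of t e'] that T(1) by auto
    then show False
      using below[OF that(1)] T(2)[of "Suc t"] T(1) that(1) by simp
  qed
  then show ?thesis
    unfolding eventually_anticipated_def by blast
qed

section \<open>Composed renamings and descent along the chain\<close>

lemma renaming_Suc: "k \<le> n \<Longrightarrow> renaming f k n = f k \<circ>\<^sub>m renaming f (Suc k) n"
  by (simp add: renaming_def upt_conv_Cons del: upt_Suc)

lemma renaming_empty: "n < k \<Longrightarrow> renaming f k n = Some"
  by (simp add: renaming_def)

lemma map_comp_eq_bind: "(g \<circ>\<^sub>m h) x = Option.bind (h x) g"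
  by (cases "h x") auto

text \<open>Downward induction from \<open>n\<close>. The index \<open>Suc k\<close> is right
  because \<open>renaming f (Suc k) n\<close> takes its values in the alphabet of
  \<open>M k\<close>; for \<open>k = n\<close> it is the identity.\<close>

lemma chain_abstract_run:
  assumes mach: "\<And>k. m \<le> k \<Longrightarrow> k \<le> n \<Longrightarrow> event_b_machine (M k)"
    and chain: "refinement_chain f M m n"
    and strat: "development_strategy f M m n"
    and run: "stuttering_run (M n) (\<lambda>t. Some (w t)) v"
    and no_ant: "\<forall>e\<in>alphabet (M n). label_of (M n) e \<noteq> Anticipated"
    and "m \<le> k" "k \<le> n"
  shows "(\<exists>v. stuttering_run (M k) (\<lambda>t. renaming f (Suc k) n (w t)) v) \<and>
         \<not> eventually_anticipated (M k) (\<lambda>t. renaming f (Suc k) n (w t))"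
  using \<open>k \<le> n\<close> \<open>m \<le> k\<close>
proof (induction k rule: inc_induct)
  case base
  \<comment> \<open>The run of \<open>M n\<close> never rests, so every candidate \<open>N\<close>
    already fails at time \<open>N\<close>.\<close>
  have "\<not> eventually_anticipated (M n) (\<lambda>t. Some (w t))"
    using run no_ant unfolding eventually_anticipated_def stuttering_run_def by blast
  then show ?case
    using run by (auto simp: renaming_empty)
next
  case (step k)
  let ?a = "\<lambda>t. renaming f (Suc (Suc k)) n (w t)"
  let ?b = "\<lambda>t. Option.bind (?a t) (f (Suc k))"
  have M: "event_b_machine (M k)" and M': "event_b_machine (M (Suc k))"
    using mach step by auto
  have "m < Suc k" "Suc k \<le> n"
    using step by auto
  then have ref: "refined_by (f (Suc k)) (M k) (M (Suc k))"
    and st: "strategy_step (f (Suc k)) (M k) (M (Suc k))"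
    using chain strat unfolding refinement_chain_def development_strategy_def
    by (metis diff_Suc_1)+
  obtain J V where via: "refines_via (f (Suc k)) (M k) (M (Suc k)) J V"
    and ran: "ran (f (Suc k)) \<subseteq> alphabet (M k)"
    using ref unfolding refined_by_def by blast
  obtain v' where v': "stuttering_run (M (Suc k)) ?a v'"
    and not_ant: "\<not> eventually_anticipated (M (Suc k)) ?a"
    using step by auto
  obtain v where v: "stuttering_run (M k) ?b v" "\<And>t. J (v t) (v' t)"
    using refinement_abstract_run[OF M M' via ran v'] by blast
  have "\<not> eventually_anticipated (M k) ?b"
    using eventually_anticipated_refinement[OF M M' via st v(1) v' v(2)] not_ant by blast
  moreover have "?b = (\<lambda>t. renaming f (Suc k) n (w t))"
    by (simp add: renaming_Suc[OF \<open>Suc k \<le> n\<close>] map_comp_eq_bind)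
  ultimately show ?case
    using v(1) by auto
qed


section \<open>Translation and restriction\<close>

text \<open>\<open>f n\<close> is applied first, and later maps can only shrink the domain.
  Finiteness makes the disjunctions in \<open>trans_ltl\<close> meaningful.\<close>

lemma finite_dom_renaming:
  assumes "finite (dom (f n))" "k \<le> n"
  shows "finite (dom (renaming f k n))"
  using assms(2)
proof (induction k rule: inc_induct)
  case base
  then show ?case
    using assms(1) by (simp add: renaming_Suc renaming_empty)
next
  case (step k)
  have "dom (renaming f k n) \<subseteq> dom (renaming f (Suc k) n)"
    using step by (auto simp: renaming_Suc map_comp_Some_iff)
  then show ?case
    using step finite_subset by blast
qed

text \<open>Replacing events without image by \<open>z\<close>, instead of deleting them, keeps all
  positions, so until is preserved position by position. At a position carrying \<open>z\<close>,
  every atom of \<open>\<phi>\<close> and its translation are false.\<close>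

lemma sat_trans_ltl:
  assumes "finite (dom h)" "z \<notin> atoms \<phi>"
  shows "Inf w \<Turnstile> trans_ltl h \<phi> \<longleftrightarrow> Inf (\<lambda>t. case h (w t) of None \<Rightarrow> z | Some x \<Rightarrow> x) \<Turnstile> \<phi>"
  using assms(2)
proof (induction \<phi> arbitrary: w)
  case (Atom x)
  have "finite {y. h y = Some x}"
    by (rule finite_subset[OF _ assms(1)]) auto
  then show ?case
    using Atom by (auto simp: sat_atoms_disj split: option.splits)
qed auto

section \<open>Reindexing along strictly monotone maps\<close>

lemma sorted_list_of_set_image_strict_mono:
  fixes c :: "nat \<Rightarrow> nat"
  assumes "strict_mono c" "finite A"
  shows "sorted_list_of_set (c ` A) = map c (sorted_list_of_set A)"
proof (rule sorted_list_of_set_unique[THEN iffD1, rotated])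
  show "sorted_wrt (<) (map c (sorted_list_of_set A)) \<and>
      set (map c (sorted_list_of_set A)) = c ` A \<and>
      length (map c (sorted_list_of_set A)) = card (c ` A)"
    using assms strict_mono_imp_inj_on[OF assms(1), of A]
    by (auto simp: sorted_wrt_map card_image strict_mono_less)
qed (use assms in simp)

text \<open>A strictly monotone map sends the least element to the least element; removing it on
  both sides gives the induction over \<open>j\<close>.\<close>

lemma enumerate_image_strict_mono:
  fixes c :: "nat \<Rightarrow> nat"
  assumes "strict_mono c" "infinite A"
  shows "enumerate (c ` A) j = c (enumerate A j)"
proof -
  have least: "enumerate (c ` A) 0 = c (enumerate A 0)" if inf: "infinite A" for A
  proof -
    obtain x where "x \<in> A"
      using infinite_imp_nonempty[OF inf] by blast
    then have "\<exists>x\<in>A. \<forall>y\<in>A. x \<le> y"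
      by (intro bexI[of _ "LEAST x. x \<in> A"]) (auto intro: LeastI Least_le)
    then show ?thesis
      unfolding enumerate_0 by (rule Least_mono[OF strict_mono_mono[OF assms(1)]])
  qed
  show ?thesis
    using assms(2)
  proof (induction j arbitrary: A)
    case 0
    then show ?case by (rule least)
  next
    case (Suc j)
    have "c ` A - {enumerate (c ` A) 0} = c ` (A - {enumerate A 0})"
      unfolding least[OF Suc.prems] using strict_mono_eq[OF assms(1)] by auto
    then show ?case
      using Suc.IH[of "A - {enumerate A 0}"] Suc.prems by (simp add: enumerate_Suc')
  qed
qed

text \<open>\<open>c\<close> matches the positions carrying elements of \<open>\<beta>\<close> in
  both sequences, in order and injectively, so the two restrictions are both finite or both infinite
  and list the same events.\<close>

lemma seq_restrict_subsequence:
  assumes "strict_mono c" "{t. w t \<in> \<beta>} \<subseteq> range c"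
  shows "seq_restrict (Inf w) \<beta> = seq_restrict (Inf (\<lambda>j. w (c j))) \<beta>"
proof -
  have eq: "{t. w t \<in> \<beta>} = c ` {j. w (c j) \<in> \<beta>}"
    using assms(2) by auto
  have "inj_on c {j. w (c j) \<in> \<beta>}"
    using strict_mono_imp_inj_on[OF assms(1)] .
  then have "finite (c ` {j. w (c j) \<in> \<beta>}) \<longleftrightarrow> finite {j. w (c j) \<in> \<beta>}"
    by (rule finite_image_iff)
  then show ?thesis
    using assms(1) unfolding seq_restrict.simps Let_def eq
    by (simp add: sorted_list_of_set_image_strict_mono enumerate_image_strict_mono)
qed

theorem lemma4:
  fixes M :: "nat \<Rightarrow> ('s, 'p, 'e) machine"
    and f :: "nat \<Rightarrow> 'e \<Rightarrow> 'e option"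
    and i n :: nat
    and \<phi> :: "'e ltl"
    and \<beta> :: "'e set"
  assumes "infinite (UNIV :: 'e set)"
    and "1 \<le> i" and "i - 1 < n"
    and "\<forall>k\<in>{i - 1..n}. event_b_machine (M k)"
    and "refinement_chain f M (i - 1) n"
    and "development_strategy f M (i - 1) n"
    and "machine_sat (M (i - 1)) \<phi>"
    and "deadlock_free (M n)"
    and "\<forall>e\<in>alphabet (M n). label_of (M n) e \<noteq> Anticipated"
    and "beta_dependent \<beta> \<phi>"
    and "\<beta> \<subseteq> alphabet (M (i - 1))"
  shows "machine_sat (M n) (trans_ltl (renaming f i n) \<phi>)"
  unfolding machine_sat_def
proof (intro allI impI)
  fix u
  assume "is_trace (M n) u"
  let ?h = "renaming f i n"
  have mach: "event_b_machine (M k)" if "i - 1 \<le> k" "k \<le> n" for k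
    using assms(4) that by simp
  have fin: "finite (alphabet (M k))" if "i - 1 \<le> k" "k \<le> n" for k
    using mach[OF that] by (simp add: event_b_machine_def)
  have "event_b_machine (M n)"
    using mach assms(3) by simp
  then obtain w v where u: "u = Inf w" and run: "stuttering_run (M n) (\<lambda>t. Some (w t)) v"
    using deadlock_free_trace_infinite assms(8) \<open>is_trace (M n) u\<close> by blast
  define a where "a t = ?h (w t)" for t
  define K where "K = {t. a t \<noteq> None}"
  \<comment> \<open>The case \<open>k = i - 1\<close>; since \<open>1 \<le> i\<close>, the renaming
    from \<open>Suc (i - 1)\<close> is \<open>?h\<close>.\<close>
  obtain v' where v': "stuttering_run (M (i - 1)) a v'"
    and not_ant: "\<not> eventually_anticipated (M (i - 1)) a"
    using chain_abstract_run[OF mach assms(5,6) run assms(9) order_refl] assms(2,3)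
    unfolding a_def by auto
  have inf: "infinite K"
  proof
    assume "finite K"
    then obtain N where "\<forall>t\<in>K. t < N"
      using finite_nat_set_iff_bounded by blast
    then have "\<forall>t\<ge>N. a t = None"
      unfolding K_def by fastforce
    then have "eventually_anticipated (M (i - 1)) a"
      unfolding eventually_anticipated_def by (metis option.distinct(1))
    with not_ant show False ..
  qed
  let ?c = "enumerate K"
  \<comment> \<open>As \<open>z\<close> lies outside the abstract alphabet, it lies outside
    \<open>\<beta>\<close> and the atoms of \<open>\<phi>\<close>: restriction erases it and no atom
    sees it.\<close>
  obtain z where z: "z \<notin> alphabet (M (i - 1))"
    using ex_new_if_finite[OF assms(1) fin[OF order_refl]] assms(3) by auto
  define w' where "w' t = (case a t of None \<Rightarrow> z | Some x \<Rightarrow> x)" for t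
  have atoms: "atoms \<phi> \<subseteq> \<beta>" and dep: "\<And>u. u \<Turnstile> \<phi> \<longleftrightarrow> seq_restrict u \<beta> \<Turnstile> \<phi>"
    using assms(10) by (auto simp: beta_dependent_def)
  have "the (a (?c j)) = w' (?c j)" for j
    using enumerate_in_set[OF inf, of j] by (auto simp: K_def w'_def)
  then have "is_trace (M (i - 1)) (Inf (\<lambda>j. w' (?c j)))"
    using trace_of_stuttering_run[OF v'] inf by (simp add: K_def)
  then have "Inf (\<lambda>j. w' (?c j)) \<Turnstile> \<phi>"
    using assms(7) by (simp add: machine_sat_def)
  moreover have "seq_restrict (Inf w') \<beta> = seq_restrict (Inf (\<lambda>j. w' (?c j))) \<beta>"
  proof (rule seq_restrict_subsequence)
    show "strict_mono ?c"
      by (rule strict_mono_enumerate[OF inf])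
    have "t \<in> K" if "w' t \<in> \<beta>" for t
      using that z assms(11) by (cases "a t") (auto simp: K_def w'_def)
    then show "{t. w' t \<in> \<beta>} \<subseteq> range ?c"
      using range_enumerate[OF inf] by blast
  qed
  \<comment> \<open>Dependence is used twice, passing through the common restriction to
    \<open>\<beta>\<close>.\<close>
  ultimately have "Inf w' \<Turnstile> \<phi>"
    using dep by metis
  moreover have "finite (dom ?h)"
  proof (rule finite_dom_renaming)
    have "dom (f n) \<subseteq> alphabet (M n)"
      using assms(3,5) by (simp add: refinement_chain_def refined_by_def)
    then show "finite (dom (f n))"
      using fin[of n] assms(3) finite_subset by auto
  qed (use assms(3) in simp)
  moreover have "z \<notin> atoms \<phi>"
    using z atoms assms(11) by blast
  ultimately show "u \<Turnstile> trans_ltl ?h \<phi>"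
    by (simp add: u sat_trans_ltl w'_def[abs_def] a_def)
qed

end
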